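(* Let $t\in\mathbb{Z}^+$ and let $P$ be any $\mathcal{C}_t^{(\mu_0,\mu_1)}$-hard problem. Then for any $(\alpha,\beta,\gamma)$-competitive (deterministic) algorithm for $P$ with respect to $(\mu_0,\mu_1)$: (i) $\alpha+\beta\geq t$, and (ii) $\alpha+(t-1)\gamma\geq t$.
   Context: Setting: online minimization problems with binary predictions; an instance is $I=(x,\hat x,r)$ with request sequence $r=\langle r_1,\dots,r_n\rangle$, $x\in\{0,1\}^n$ encoding a fixed optimal solution, $\hat x\in\{0,1\}^n$ its prediction, with $\hat x_i$ revealed together with $r_i$. Error measures: $\mu_0(I)=\sum_i x_i(1-\hat x_i)$ and $\mu_1(I)=\sum_i(1-x_i)\hat x_i$. A deterministic online algorithm is $(\alpha,\beta,\gamma)$-competitive w.r.t. $(\mu_0,\mu_1)$ if there is a constant $\kappa$ with $\mathrm{Alg}(I)\le\alpha\,\mathrm{Opt}(I)+\beta\,\mu_0(I)+\gamma\,\mu_1(I)+\kappa$ for all $I$. $Q$ is as hard as $P$ if existence of an $(\alpha,\beta,\gamma)$-competitive algorithm for $Q$ w.r.t. $(\mu_0,\mu_1)$ implies existence of one for $P$ w.r.t. $(\mu_0,\mu_1)$. $\mathrm{ASG}_t$: each request $r_i$ prompts an output bit $y_i$, with $\hat x_i$ revealed together with $r_i$; $x$ is revealed after the last request; cost $\sum_i(y_i+t\,x_i(1-y_i))$. A problem $P$ is $\mathcal{C}_t^{(\mu_0,\mu_1)}$-hard if $P$ is as hard as $\mathrm{ASG}_t$. *)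

theory Defs
  imports Complex_Main
begin

text \<open>An instance is a triple \<open>(x, xhat, r)\<close>; the bits 0 and 1 are \<open>False\<close> and \<open>True\<close>.\<close>

type_synonym 'r inst = "bool list \<times> bool list \<times> 'r list"

text \<open>
  \<open>inputs\<close> is the set of admissible pairs \<open>(x, r)\<close>, \<open>solutions P x r\<close> the set of feasible output
  sequences and \<open>decode P x r\<close> the optimal solution that is encoded by \<open>x\<close>.
  Solutions and costs may depend on \<open>x\<close> because, as in string guessing, \<open>x\<close> may be
  information that is only revealed after the last request.
\<close>

record ('r, 'o) online_problem =
  inputs :: "(bool list \<times> 'r list) set"
  solutions :: "bool list \<Rightarrow> 'r list \<Rightarrow> 'o list set"
  cost :: "bool list \<Rightarrow> 'r list \<Rightarrow> 'o list \<Rightarrow> real"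
  decode :: "bool list \<Rightarrow> 'r list \<Rightarrow> 'o list"

definition online_min_problem :: "('r, 'o) online_problem \<Rightarrow> bool" where
  "online_min_problem P \<longleftrightarrow>
     (\<forall>(x, r) \<in> inputs P.
        length x = length r \<and>
        (\<forall>y \<in> solutions P x r. length y = length r) \<and>
        decode P x r \<in> solutions P x r \<and>
        (\<forall>y \<in> solutions P x r. cost P x r (decode P x r) \<le> cost P x r y))"

definition instances :: "('r, 'o) online_problem \<Rightarrow> 'r inst set" where
  "instances P = {(x, xhat, r). (x, r) \<in> inputs P \<and> length xhat = length r}"

fun Opt :: "('r, 'o) online_problem \<Rightarrow> 'r inst \<Rightarrow> real" where
  "Opt P (x, xhat, r) = (INF y \<in> solutions P x r. cost P x r y)"

fun mu0 :: "'r inst \<Rightarrow> real" where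
  "mu0 (x, xhat, r) = (\<Sum>i<length r. of_bool (x ! i) * (1 - of_bool (xhat ! i)))"

fun mu1 :: "'r inst \<Rightarrow> real" where
  "mu1 (x, xhat, r) = (\<Sum>i<length r. (1 - of_bool (x ! i)) * of_bool (xhat ! i))"

text \<open>
  A deterministic online algorithm maps the requests and predictions seen so far, the current ones
  included, to the current output. Its earlier outputs are determined by the same data.
\<close>

type_synonym ('r, 'o) online_alg = "('r \<times> bool) list \<Rightarrow> 'o"

definition run :: "('r, 'o) online_alg \<Rightarrow> bool list \<Rightarrow> 'r list \<Rightarrow> 'o list" where
  "run A xhat r = map (\<lambda>i. A (take (Suc i) (zip r xhat))) [0..<length r]"

definition online_algorithm_for :: "('r, 'o) online_problem \<Rightarrow> ('r, 'o) online_alg \<Rightarrow> bool" where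
  "online_algorithm_for P A \<longleftrightarrow>
     (\<forall>(x, xhat, r) \<in> instances P. run A xhat r \<in> solutions P x r)"

fun Alg :: "('r, 'o) online_problem \<Rightarrow> ('r, 'o) online_alg \<Rightarrow> 'r inst \<Rightarrow> real" where
  "Alg P A (x, xhat, r) = cost P x r (run A xhat r)"

definition competitive ::
  "('r, 'o) online_problem \<Rightarrow> ('r, 'o) online_alg \<Rightarrow> real \<Rightarrow> real \<Rightarrow> real \<Rightarrow> bool" where
  "competitive P A \<alpha> \<beta> \<gamma> \<longleftrightarrow>
     online_algorithm_for P A \<and>
     (\<exists>\<kappa>. \<forall>I \<in> instances P. Alg P A I \<le> \<alpha> * Opt P I + \<beta> * mu0 I + \<gamma> * mu1 I + \<kappa>)"

definition as_hard_as :: "('r, 'o) online_problem \<Rightarrow> ('s, 'p) online_problem \<Rightarrow> bool" where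
  "as_hard_as Q P \<longleftrightarrow>
     (\<forall>\<alpha> \<beta> \<gamma>. (\<exists>A. competitive Q A \<alpha> \<beta> \<gamma>) \<longrightarrow> (\<exists>B. competitive P B \<alpha> \<beta> \<gamma>))"

text \<open>The requests of string guessing are mere prompts, hence of type \<open>unit\<close>.\<close>

definition ASG :: "nat \<Rightarrow> (unit, bool) online_problem" where
  "ASG t =
     \<lparr>inputs = {(x, r). length x = length r},
      solutions = (\<lambda>x r. {y. length y = length r}),
      cost = (\<lambda>x r y. \<Sum>i<length r. of_bool (y ! i) + real t * of_bool (x ! i) * (1 - of_bool (y ! i))),
      decode = (\<lambda>x r. x)\<rparr>"

definition C_hard :: "nat \<Rightarrow> ('r, 'o) online_problem \<Rightarrow> bool" where
  "C_hard t P \<longleftrightarrow> as_hard_as P (ASG t)"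

lemma online_min_problem_ASG:
  assumes "t > 0"
  shows "online_min_problem (ASG t)"
  using assms unfolding online_min_problem_def ASG_def
  by (auto intro!: sum_mono simp: of_bool_def)

lemma Opt_ASG:
  assumes "t > 0" and "(x, xhat, r) \<in> instances (ASG t)"
  shows "Opt (ASG t) (x, xhat, r) = (\<Sum>i<length r. of_bool (x ! i))"
proof -
  have len: "length x = length r"
    using assms(2) by (simp add: instances_def ASG_def)
  let ?c = "cost (ASG t) x r"
  have cx: "?c x = (\<Sum>i<length r. of_bool (x ! i))"
    unfolding ASG_def by (auto intro!: sum.cong simp: of_bool_def)
  have "(INF y \<in> solutions (ASG t) x r. ?c y) = ?c x"
  proof (rule cInf_eq_minimum)
    show "?c x \<in> ?c ` solutions (ASG t) x r"
      using len by (simp add: ASG_def)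
    show "?c x \<le> z" if "z \<in> ?c ` solutions (ASG t) x r" for z
      using that assms(1) unfolding ASG_def
      by (auto intro!: sum_mono simp: of_bool_def)
  qed
  then show ?thesis
    by (simp add: cx)
qed

end

theory Submission
  imports Defs
begin

text \<open>
  It suffices to bound the parameters of an algorithm for string guessing. Its output
  depends only on the prediction, so the adversary may choose \<open>x\<close> after seeing the output.
  For (i), predict all zeros and let \<open>x\<close> be the complement of the output.
  For (ii), predict all ones and average over the \<open>t\<close> strings \<open>x\<close> whose ones are the positions
  in a fixed residue class modulo \<open>t\<close>: whatever the output at a position is, its costs for
  these \<open>t\<close> strings add up to \<open>t\<close>, while the sum of \<open>\<alpha> Opt + \<gamma> mu1\<close> is \<open>\<alpha> + (t - 1) \<gamma>\<close>
  per position.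
\<close>

text \<open>The order of quantifiers carries the content: \<open>y\<close> precedes \<open>x\<close>
  because \<open>run\<close> never reads \<open>x\<close>, and \<kappa> precedes \<open>n\<close>
  and \<open>p\<close>, so it stays fixed as the length grows.\<close>

lemma competitive_ASG_bound:
  assumes "t > 0" and "competitive (ASG t) B \<alpha> \<beta> \<gamma>"
  obtains \<kappa> where
    "\<And>(n::nat) p. \<exists>y. \<forall>x.
       (\<Sum>i<n. of_bool (y i) + real t * of_bool (x i) * (1 - of_bool (y i)))
         \<le> \<alpha> * (\<Sum>i<n. of_bool (x i)) + \<beta> * (\<Sum>i<n. of_bool (x i) * (1 - of_bool (p i)))
           + \<gamma> * (\<Sum>i<n. (1 - of_bool (x i)) * of_bool (p i)) + \<kappa>"
proof -
  obtain \<kappa> where \<kappa>: "Alg (ASG t) B I \<le> \<alpha> * Opt (ASG t) I + \<beta> * mu0 I + \<gamma> * mu1 I + \<kappa>"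
    if "I \<in> instances (ASG t)" for I
    using assms(2) unfolding competitive_def by blast
  show thesis
  proof (rule that)
    fix n :: nat and p :: "nat \<Rightarrow> bool"
    let ?r = "replicate n ()" and ?xhat = "map p [0..<n]"
    let ?y = "\<lambda>i. run B ?xhat ?r ! i"
    show "\<exists>y. \<forall>x.
       (\<Sum>i<n. of_bool (y i) + real t * of_bool (x i) * (1 - of_bool (y i)))
         \<le> \<alpha> * (\<Sum>i<n. of_bool (x i)) + \<beta> * (\<Sum>i<n. of_bool (x i) * (1 - of_bool (p i)))
           + \<gamma> * (\<Sum>i<n. (1 - of_bool (x i)) * of_bool (p i)) + \<kappa>"
    proof (intro exI[of _ ?y] allI)
      fix x :: "nat \<Rightarrow> bool"
      let ?x = "map x [0..<n]"
      have inst: "(?x, ?xhat, ?r) \<in> instances (ASG t)"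
        by (simp add: instances_def ASG_def)
      have "Alg (ASG t) B (?x, ?xhat, ?r)
          = (\<Sum>i<n. of_bool (?y i) + real t * of_bool (x i) * (1 - of_bool (?y i)))"
        by (simp add: ASG_def)
      then show "(\<Sum>i<n. of_bool (?y i) + real t * of_bool (x i) * (1 - of_bool (?y i)))
         \<le> \<alpha> * (\<Sum>i<n. of_bool (x i)) + \<beta> * (\<Sum>i<n. of_bool (x i) * (1 - of_bool (p i)))
           + \<gamma> * (\<Sum>i<n. (1 - of_bool (x i)) * of_bool (p i)) + \<kappa>"
        using \<kappa>[OF inst] by (simp add: Opt_ASG[OF assms(1) inst] del: Opt.simps Alg.simps)
    qed
  qed
qed

text \<open>This removes the additive constant: a positive gain \<open>d\<close> per position would
  outgrow any \<kappa> on long inputs.\<close>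

lemma nonpos_if_multiples_bounded:
  fixes d \<kappa> :: real
  assumes "\<And>n::nat. real n * d \<le> \<kappa>"
  shows "d \<le> 0"
proof (rule ccontr)
  assume "\<not> d \<le> 0"
  then obtain n :: nat where "\<kappa> < real n * d"
    using reals_Archimedean3[of d] by auto
  then show False
    using assms[of n] by simp
qed

lemma competitive_ASG_zero_prediction:
  assumes "t > 0" and "competitive (ASG t) B \<alpha> \<beta> \<gamma>"
  shows "\<alpha> + \<beta> \<ge> real t"
proof -
  obtain \<kappa> where \<kappa>: "\<And>(n::nat) p. \<exists>y. \<forall>x.
       (\<Sum>i<n. of_bool (y i) + real t * of_bool (x i) * (1 - of_bool (y i)))
         \<le> \<alpha> * (\<Sum>i<n. of_bool (x i)) + \<beta> * (\<Sum>i<n. of_bool (x i) * (1 - of_bool (p i)))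
           + \<gamma> * (\<Sum>i<n. (1 - of_bool (x i)) * of_bool (p i)) + \<kappa>"
    using competitive_ASG_bound[OF assms] by blast
  \<comment> \<open>The least excess of cost over (\<alpha> + \<beta>) * \<open>x i\<close> at a
    position, for \<open>x\<close> the complement of \<open>y\<close>: it is 1 if \<open>y i\<close>
    holds and t - (\<alpha> + \<beta>) otherwise. As 1 is positive, \<open>d\<close> \<le> 0 must
    come from the second term.\<close>
  define d where "d = min 1 (real t - (\<alpha> + \<beta>))"
  have "real n * d \<le> \<kappa>" for n
  proof -
    obtain y where y: "\<forall>x.
       (\<Sum>i<n. of_bool (y i) + real t * of_bool (x i) * (1 - of_bool (y i)))
         \<le> \<alpha> * (\<Sum>i<n. of_bool (x i)) + \<beta> * (\<Sum>i<n. of_bool (x i) * (1 - of_bool False))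
           + \<gamma> * (\<Sum>i<n. (1 - of_bool (x i)) * of_bool False) + \<kappa>"
      using \<kappa>[of n "\<lambda>_. False"] by blast
    have "real n * d = (\<Sum>i<n. d)"
      by simp
    also have "\<dots> \<le> (\<Sum>i<n. of_bool (y i) + real t * of_bool (\<not> y i) * (1 - of_bool (y i))
        - (\<alpha> + \<beta>) * of_bool (\<not> y i))"
      by (rule sum_mono) (auto simp: d_def)
    \<comment> \<open>With no predicted ones, the \<gamma> term vanishes and the \<beta> sum equals
      the \<alpha> sum.\<close>
    also have "\<dots> \<le> \<kappa>"
      using spec[OF y, of "\<lambda>i. \<not> y i"]
      by (simp add: sum_subtractf sum.distrib distrib_right flip: sum_distrib_left)
    finally show ?thesis .
  qed
  then have "d \<le> 0"
    by (rule nonpos_if_multiples_bounded)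
  then show ?thesis
    by (simp add: d_def min_def split: if_splits)
qed

lemma competitive_ASG_one_prediction:
  assumes "t > 0" and "competitive (ASG t) B \<alpha> \<beta> \<gamma>"
  shows "\<alpha> + (real t - 1) * \<gamma> \<ge> real t"
proof -
  obtain \<kappa> where \<kappa>: "\<And>(n::nat) p. \<exists>y. \<forall>x.
       (\<Sum>i<n. of_bool (y i) + real t * of_bool (x i) * (1 - of_bool (y i)))
         \<le> \<alpha> * (\<Sum>i<n. of_bool (x i)) + \<beta> * (\<Sum>i<n. of_bool (x i) * (1 - of_bool (p i)))
           + \<gamma> * (\<Sum>i<n. (1 - of_bool (x i)) * of_bool (p i)) + \<kappa>"
    using competitive_ASG_bound[OF assms] by blast
  have "real n * (real t - (\<alpha> + (real t - 1) * \<gamma>)) \<le> real t * \<kappa>" for n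
  proof -
    obtain y where y: "\<forall>x.
       (\<Sum>i<n. of_bool (y i) + real t * of_bool (x i) * (1 - of_bool (y i)))
         \<le> \<alpha> * (\<Sum>i<n. of_bool (x i)) + \<beta> * (\<Sum>i<n. of_bool (x i) * (1 - of_bool True))
           + \<gamma> * (\<Sum>i<n. (1 - of_bool (x i)) * of_bool True) + \<kappa>"
      using \<kappa>[of n "\<lambda>_. True"] by blast
    \<comment> \<open>The excess of cost over the bound at position \<open>i\<close> when the ones
      of \<open>x\<close> form residue class \<open>j\<close>. The \<beta> term is absent because
      every predicted bit is 1.\<close>
    let ?f = "\<lambda>i j. of_bool (y i) + real t * of_bool (i mod t = j) * (1 - of_bool (y i))
        - (\<alpha> * of_bool (i mod t = j) + \<gamma> * (1 - of_bool (i mod t = j)))"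
    have col: "(\<Sum>j<t. ?f i j) = real t - (\<alpha> + (real t - 1) * \<gamma>)" for i
    proof -
      have one: "(\<Sum>j<t. of_bool (i mod t = j)) = (1::real)"
        using assms(1) by (simp add: of_bool_def)
      \<comment> \<open>Split off the part independent of \<open>j\<close>; the rest counts once, as
        \<open>i\<close> lies in exactly one class. Then \<open>y i\<close> cancels.\<close>
      have "(\<Sum>j<t. ?f i j) = (\<Sum>j<t. (of_bool (y i) - \<gamma>)
          + (real t * (1 - of_bool (y i)) - \<alpha> + \<gamma>) * of_bool (i mod t = j))"
        by (rule sum.cong) (auto simp: algebra_simps)
      also have "\<dots> = real t * (of_bool (y i) - \<gamma>) + (real t * (1 - of_bool (y i)) - \<alpha> + \<gamma>)"
        by (simp only: sum.distrib one mult_1_right flip: sum_distrib_left) simp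
      finally show ?thesis
        by (simp add: algebra_simps)
    qed
    have row: "(\<Sum>i<n. ?f i j) \<le> \<kappa>" for j
      using spec[OF y, of "\<lambda>i. i mod t = j"]
      by (simp add: sum_subtractf sum.distrib flip: sum_distrib_left)
    \<comment> \<open>Double counting: each of the t strings costs one \<kappa>, so the total bound
      does not depend on \<open>n\<close>.\<close>
    have "real n * (real t - (\<alpha> + (real t - 1) * \<gamma>)) = (\<Sum>i<n. \<Sum>j<t. ?f i j)"
      by (simp only: col) simp
    also have "\<dots> = (\<Sum>j<t. \<Sum>i<n. ?f i j)"
      by (rule sum.swap)
    also have "\<dots> \<le> (\<Sum>j<t. \<kappa>)"
      by (intro sum_mono row)
    finally show ?thesis
      by simp
  qed
  then have "real t - (\<alpha> + (real t - 1) * \<gamma>) \<le> 0"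
    by (rule nonpos_if_multiples_bounded)
  then show ?thesis
    by simp
qed

theorem theorem58:
  fixes t :: nat
    and P :: "('r, 'o) online_problem"
    and A :: "('r, 'o) online_alg"
    and \<alpha> \<beta> \<gamma> :: real
  assumes "t > 0"
    and "online_min_problem P"
    and "C_hard t P"
    and "competitive P A \<alpha> \<beta> \<gamma>"
  shows "\<alpha> + \<beta> \<ge> real t \<and> \<alpha> + (real t - 1) * \<gamma> \<ge> real t"
proof -
  obtain B where "competitive (ASG t) B \<alpha> \<beta> \<gamma>"
    using assms(3,4) unfolding C_hard_def as_hard_as_def by blast
  then show ?thesis
    using competitive_ASG_zero_prediction competitive_ASG_one_prediction assms(1) by blast
qed

end
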